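(* Let $F_G=0.0796$, let $x_c=\Phi^{-1}(1-F_G)$, and for real $\varepsilon_3$ let $F_{\rm C}(\varepsilon_3)$ and $F_{\rm V}(\varepsilon_3)$ be the cluster and void fractions of the first-order Edgeworth density, that is, $$F_{\rm C}(\varepsilon_3)=\int_{x_c}^{\infty}\phi(\nu)\left[1+\frac{\varepsilon_3}{6}H_3(\nu)\right]d\nu,\qquad F_{\rm V}(\varepsilon_3)=\int_{-\infty}^{-x_c}\phi(\nu)\left[1+\frac{\varepsilon_3}{6}H_3(\nu)\right]d\nu .$$ Put $A=\frac{(x_c^2-1)\,\phi(x_c)}{6}$. Then $$F_{\rm C}(\varepsilon_3)=F_G+A\,\varepsilon_3,\qquad F_{\rm V}(\varepsilon_3)=F_G-A\,\varepsilon_3,$$ and consequently the cluster-void asymmetry satisfies $$\frac{F_{\rm C}(\varepsilon_3)-F_{\rm V}(\varepsilon_3)}{F_G}=\frac{2A}{F_G}\,\varepsilon_3,$$ where $\frac{2A}{F_G}=0.609$ to three decimal places.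
   Context: $\phi(\nu)=e^{-\nu^2/2}/\sqrt{2\pi}$ is the standard normal density, $\Phi$ the standard normal cumulative distribution function, and $H_3(x)=x^3-3x$ the third (probabilists') Hermite polynomial. Here $\nu=\delta/\sigma$ is the normalized density contrast, and $\varepsilon_3$ is the dimensionless third-cumulant amplitude (reduced skewness times rms density fluctuation). In this model the cluster (void) fraction is the probability that $\nu$ lies above $x_c$ (below $-x_c$), with $x_c$ calibrated so that for $\varepsilon_3=0$ both fractions equal the Gaussian value $F_G=7.96\%$. The asymmetry is denoted $\mathcal{R}_{\rm cv}-1$ and is defined as $(F_{\rm C}-F_{\rm V})/F_G$. *)

theory Defs
  imports "HOL-Probability.Probability"
begin

definition Phi :: "real \<Rightarrow> real" where
  "Phi = cdf std_normal_distribution"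

definition H3 :: "real \<Rightarrow> real" where
  "H3 x = x ^ 3 - 3 * x"

definition F_G :: real where
  "F_G = 0.0796"

definition x_c :: real where
  "x_c = the_inv Phi (1 - F_G)"

(* First-order Edgeworth density of the normalized contrast; for large \<epsilon> it takes
   negative values, so it is treated as a plain real function rather than a measure. *)
definition edgeworth_density :: "real \<Rightarrow> real \<Rightarrow> real" where
  "edgeworth_density \<epsilon> \<nu> = std_normal_density \<nu> * (1 + \<epsilon> / 6 * H3 \<nu>)"

definition cluster_fraction :: "real \<Rightarrow> real" where
  "cluster_fraction \<epsilon> = (LBINT \<nu>:{x_c..}. edgeworth_density \<epsilon> \<nu>)"

definition void_fraction :: "real \<Rightarrow> real" where
  "void_fraction \<epsilon> = (LBINT \<nu>:{..-x_c}. edgeworth_density \<epsilon> \<nu>)"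

definition asymmetry :: "real \<Rightarrow> real" where
  "asymmetry \<epsilon> = (cluster_fraction \<epsilon> - void_fraction \<epsilon>) / F_G"

definition response_amplitude :: real where
  "response_amplitude = (x_c\<^sup>2 - 1) * std_normal_density x_c / 6"

end

theory Submission
  imports Defs "HOL-Real_Asymp.Real_Asymp"
begin

text \<open>
  Since \<open>(x\<^sup>2 - 1) \<phi>(x)\<close> has derivative \<open>-\<phi>(x) H\<^sub>3(x)\<close>, the skewness correction to the upper tail
  integrates in closed form, and the parity of \<open>\<phi>\<close> and \<open>H\<^sub>3\<close> transfers it to the lower tail.
  The numerical value follows from \<open>1.4077 < x\<^sub>c < 1.4079\<close>, which is obtained by integrating
  the alternating Taylor bounds for \<open>exp (-t\<^sup>2/2)\<close> termwise from \<open>0\<close>.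
\<close>

section \<open>The standard normal distribution function\<close>

lemma std_normal_density_minus: "std_normal_density (- x) = std_normal_density x"
  by (simp add: std_normal_density_def)

lemma continuous_on_std_normal_density: "continuous_on A std_normal_density"
  unfolding std_normal_density_def by (intro continuous_intros) auto

lemma set_integrable_std_normal_density_mult_power:
  assumes "A \<in> sets borel"
  shows "set_integrable lborel A (\<lambda>x. std_normal_density x * x ^ k)"
  using integrable_mult_indicator[OF _ integrable_std_normal_moment[of k], of A] assms
  by (simp add: set_integrable_def)

lemma set_integrable_std_normal_density:
  assumes "A \<in> sets borel"
  shows "set_integrable lborel A std_normal_density"
  using set_integrable_std_normal_density_mult_power[OF assms, of 0] by simp

lemma Phi_eq_integral: "Phi x = (LBINT t:{..x}. std_normal_density t)"
proof -
  interpret real_distribution std_normal_distribution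
    by (rule real_dist_normal_dist)
  have "Phi x = (LINT t|std_normal_distribution. indicator {..x} t)"
    by (simp add: Phi_def cdf_def2)
  also have "\<dots> = (LINT t|lborel. std_normal_density t *\<^sub>R indicator {..x} t)"
    by (rule integral_density) auto
  finally show ?thesis
    by (simp add: set_lebesgue_integral_def mult.commute)
qed

text \<open>Splitting off a fixed base point \<open>a\<close> leaves an integral over a compact
  interval, to which the fundamental theorem of calculus applies.\<close>

lemma Phi_add_integral:
  assumes "a \<le> x"
  shows "Phi x = Phi a + integral {a..x} std_normal_density"
proof -
  have "{..x} = {..a} \<union> {a<..x}"
    using assms by auto
  then have "Phi x = Phi a + (LBINT t:{a<..x}. std_normal_density t)"
    unfolding Phi_eq_integral
    by (auto intro!: set_integral_Un set_integrable_std_normal_density)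
  also have "(LBINT t:{a<..x}. std_normal_density t) = (LBINT t:{a..x}. std_normal_density t)"
    by (rule set_integral_discrete_difference[where X="{a}"]) auto
  also have "\<dots> = integral {a..x} std_normal_density"
    by (rule set_borel_integral_eq_integral) (simp add: set_integrable_std_normal_density)
  finally show ?thesis .
qed

lemma DERIV_Phi: "(Phi has_real_derivative std_normal_density x) (at x)"
proof -
  \<comment> \<open>Any window with \<open>x\<close> in its interior would do: the derivative within
    it is then the full derivative at \<open>x\<close>.\<close>
  let ?a = "x - 1" and ?b = "x + 1"
  have "((\<lambda>y. Phi ?a + integral {?a..y} std_normal_density)
      has_real_derivative (0 + std_normal_density x)) (at x within {?a..?b})"
    by (intro DERIV_add DERIV_const integral_has_real_derivative
        continuous_on_std_normal_density) auto
  then have "(Phi has_real_derivative std_normal_density x) (at x within {?a..?b})"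
    by (rule has_field_derivative_transform_within[where d=1, THEN DERIV_cong])
      (auto simp: Phi_add_integral[of ?a, symmetric])
  moreover have "at x within {?a..?b} = at x"
    by (rule at_within_interior) simp
  ultimately show ?thesis
    by (simp only:)
qed

text \<open>The density is positive everywhere. The resulting injectivity gives
  \<open>the_inv Phi\<close> its meaning in \<open>x_c\<close>.\<close>

lemma strict_mono_Phi: "strict_mono Phi"
proof (rule strict_monoI)
  fix x y :: real
  assume "x < y"
  moreover have "\<exists>d. (Phi has_real_derivative d) (at z) \<and> 0 < d" for z
    using DERIV_Phi[of z] normal_density_pos[of 1 0 z] by auto
  ultimately show "Phi x < Phi y"
    by (rule DERIV_pos_imp_increasing)
qed

lemma upper_tail_eq: "(LBINT t:{x..}. std_normal_density t) = 1 - Phi x"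
proof -
  have "UNIV = {..x} \<union> {x<..}"
    by auto
  then have "(LBINT t:UNIV. std_normal_density t)
      = (LBINT t:{..x} \<union> {x<..}. std_normal_density t)"
    by simp
  also have "\<dots> = Phi x + (LBINT t:{x<..}. std_normal_density t)"
    unfolding Phi_eq_integral
    by (intro set_integral_Un set_integrable_std_normal_density) auto
  also have "(LBINT t:{x<..}. std_normal_density t) = (LBINT t:{x..}. std_normal_density t)"
    by (rule set_integral_discrete_difference[where X="{x}"]) auto
  finally show ?thesis
    by (simp add: set_lebesgue_integral_def)
qed

text \<open>The reflection t -> -t carries the lower tail to the upper one and preserves the
  density; \<open>atLeast_def\<close> folds the reflected set back into
  \<open>{x..}\<close>.\<close>

lemma Phi_minus: "Phi (- x) = 1 - Phi x"
  by (simp add: Phi_eq_integral[of "- x"] set_integral_reflect[of "{..- x}"]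
      std_normal_density_minus upper_tail_eq atLeast_def[symmetric])

lemma Phi_0: "Phi 0 = 1 / 2"
  using Phi_minus[of 0] by simp


section \<open>Tails of the Edgeworth density\<close>

lemma set_integrable_std_normal_density_H3:
  assumes "A \<in> sets borel"
  shows "set_integrable lborel A (\<lambda>t. std_normal_density t * H3 t)"
proof -
  \<comment> \<open>Both terms are Gaussian moments; the exponent 1 is kept so that the second has
    that shape too.\<close>
  have "set_integrable lborel A
      (\<lambda>t. std_normal_density t * t ^ 3 - 3 * (std_normal_density t * t ^ 1))"
    by (intro set_integral_diff set_integrable_mult_right
        set_integrable_std_normal_density_mult_power assms)
  then show ?thesis
    by (simp add: H3_def algebra_simps)
qed

lemma DERIV_std_normal_density:
  "(std_normal_density has_real_derivative (- x * std_normal_density x)) (at x)"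
proof -
  have "((\<lambda>x. 1 / sqrt (2 * pi) * exp (- x\<^sup>2 / 2))
      has_real_derivative 1 / sqrt (2 * pi) * (- x * exp (- x\<^sup>2 / 2))) (at x)"
    by (intro DERIV_cmult) (auto intro!: derivative_eq_intros)
  then show ?thesis
    unfolding std_normal_density_def by (simp add: mult.left_commute)
qed

text \<open>The third derivative of the density is -H3 times the density, so minus its second
  derivative, \<open>?F\<close>, is an antiderivative. It vanishes at infinity, and only the
  boundary term at \<open>x\<close> survives.\<close>

lemma upper_tail_H3:
  "(LBINT t:{x..}. std_normal_density t * H3 t) = (x\<^sup>2 - 1) * std_normal_density x"
proof -
  let ?F = "\<lambda>t. - ((t\<^sup>2 - 1) * std_normal_density t)"
  have deriv: "(?F has_real_derivative std_normal_density t * H3 t) (at t)" for t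
    by (auto intro!: derivative_eq_intros DERIV_std_normal_density
        simp: H3_def power2_eq_square power3_eq_cube algebra_simps)
  have cont: "isCont (\<lambda>t. std_normal_density t * H3 t) t" for t
    unfolding std_normal_density_def H3_def by (intro continuous_intros) auto
  have "isCont ?F x"
    by (rule DERIV_isCont[OF deriv])
  \<comment> \<open>The fundamental theorem for interval integrals takes its boundary values as
    one-sided limits in the extended reals.\<close>
  then have left: "((?F \<circ> real_of_ereal) \<longlongrightarrow> ?F x) (at_right (ereal x))"
    by (simp add: ereal_tendsto_simps isCont_def filterlim_at_split)
  have "(?F \<longlongrightarrow> 0) at_top"
    unfolding std_normal_density_def by real_asymp
  then have right: "((?F \<circ> real_of_ereal) \<longlongrightarrow> 0) (at_left \<infinity>)"
    by (simp add: ereal_tendsto_simps)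
  have "(LBINT t:{x..}. std_normal_density t * H3 t)
      = (LBINT t:{x<..}. std_normal_density t * H3 t)"
    by (rule set_integral_discrete_difference[where X="{x}"]) auto
  also have "\<dots> = (LBINT t=ereal x..\<infinity>. std_normal_density t * H3 t)"
    by (simp add: interval_integral_to_infinity_eq)
  also have "\<dots> = 0 - ?F x"
    using deriv
    by (intro interval_integral_FTC_integrable[where F="?F"] left right cont
        set_integrable_std_normal_density_H3)
      (auto simp: has_real_derivative_iff_has_vector_derivative)
  finally show ?thesis
    by simp
qed

lemma upper_tail_edgeworth_density:
  "(LBINT t:{x..}. edgeworth_density \<epsilon> t)
    = 1 - Phi x + \<epsilon> / 6 * ((x\<^sup>2 - 1) * std_normal_density x)"
proof -
  have "(LBINT t:{x..}. edgeworth_density \<epsilon> t)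
      = (LBINT t:{x..}. std_normal_density t + \<epsilon> / 6 * (std_normal_density t * H3 t))"
    by (simp add: edgeworth_density_def algebra_simps)
  also have "\<dots> = (LBINT t:{x..}. std_normal_density t)
      + (LBINT t:{x..}. \<epsilon> / 6 * (std_normal_density t * H3 t))"
    by (intro set_integral_add set_integrable_mult_right
        set_integrable_std_normal_density set_integrable_std_normal_density_H3) auto
  finally show ?thesis
    by (simp add: upper_tail_eq upper_tail_H3)
qed

text \<open>The density is even and \<open>H3\<close> odd, so reflection only flips the sign of the
  amplitude; this reduces the void tail to the cluster tail.\<close>

lemma edgeworth_density_minus: "edgeworth_density \<epsilon> (- t) = edgeworth_density (- \<epsilon>) t"
  by (simp add: edgeworth_density_def std_normal_density_minus H3_def power3_eq_cube algebra_simps)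

lemma lower_tail_edgeworth_density:
  "(LBINT t:{..- x}. edgeworth_density \<epsilon> t) = (LBINT t:{x..}. edgeworth_density (- \<epsilon>) t)"
  by (simp add: set_integral_reflect[of "{..- x}"] edgeworth_density_minus atLeast_def[symmetric])


section \<open>Numerical bounds\<close>

text \<open>Lagrange form of the remainder. As \<open>exp t\<close> is positive, for u \<ge> 0 the
  parity of \<open>n\<close> alone decides whether the partial sum bounds from below or
  above.\<close>

lemma exp_minus_Taylor_remainder:
  fixes u :: real
  obtains t where
    "exp (- u) = (\<Sum>m<n. (- u) ^ m / fact m) + exp t / fact n * (- u) ^ n"
  using Maclaurin_exp_le[of "- u" n] by blast

lemma exp_minus_ge_Taylor_even:
  fixes u :: real
  assumes "u \<ge> 0" "even n"
  shows "(\<Sum>m<n. (- u) ^ m / fact m) \<le> exp (- u)"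
  using assms by (rule_tac exp_minus_Taylor_remainder[of u n]) simp

lemma exp_minus_le_Taylor_odd:
  fixes u :: real
  assumes "u \<ge> 0" "odd n"
  shows "exp (- u) \<le> (\<Sum>m<n. (- u) ^ m / fact m)"
  using assms by (rule_tac exp_minus_Taylor_remainder[of u n]) simp

text \<open>The first \<open>n\<close> terms of the Maclaurin series of the integral of exp (-t^2/2)
  from 0 to \<open>x\<close>, that is, of sqrt (2 pi) * (Phi x - 1/2).\<close>

definition gauss_Taylor :: "nat \<Rightarrow> real \<Rightarrow> real" where
  "gauss_Taylor n x = (\<Sum>m<n. (- 1) ^ m * x ^ (2 * m + 1) / (2 ^ m * fact m * real (2 * m + 1)))"

lemma gauss_Taylor_0: "gauss_Taylor n 0 = 0"
  by (simp add: gauss_Taylor_def)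

lemma DERIV_gauss_Taylor:
  "(gauss_Taylor n has_real_derivative (\<Sum>m<n. (- (x\<^sup>2 / 2)) ^ m / fact m)) (at x)"
proof -
  have "((\<lambda>x. (- 1) ^ m * x ^ (2 * m + 1) / (2 ^ m * fact m * real (2 * m + 1)))
      has_real_derivative (- (x\<^sup>2 / 2)) ^ m / fact m) (at x)" for m
  proof -
    have "((\<lambda>x. (- 1) ^ m / (2 ^ m * fact m * real (2 * m + 1)) * x ^ (2 * m + 1))
        has_real_derivative (- 1) ^ m / (2 ^ m * fact m * real (2 * m + 1))
          * (real (2 * m + 1) * x ^ (2 * m))) (at x)"
      by (intro DERIV_cmult) (use DERIV_pow[of "2 * m + 1" x UNIV] in simp)
    moreover have "(- 1) ^ m / (2 ^ m * fact m * real (2 * m + 1)) * (real (2 * m + 1) * x ^ (2 * m))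
        = (- 1) ^ m * (x\<^sup>2) ^ m / (2 ^ m * fact m)"
      \<comment> \<open>Left unexpanded, \<open>real (2 * m + 1)\<close> cancels as a single
        factor.\<close>
      unfolding power_mult[symmetric] by (simp del: of_nat_add of_nat_mult)
    moreover have "\<dots> = (- (x\<^sup>2 / 2)) ^ m / fact m"
      by (subst power_minus) (simp add: power_divide)
    ultimately show ?thesis
      by simp
  qed
  then show ?thesis
    unfolding gauss_Taylor_def by (intro DERIV_sum)
qed

text \<open>The difference of the two sides is 0 at the origin, and its derivative is nonnegative by
  the exponential bound at u = y^2/2.\<close>

lemma Phi_ge_gauss_Taylor_even:
  assumes "x \<ge> 0" "even n"
  shows "1 / 2 + gauss_Taylor n x / sqrt (2 * pi) \<le> Phi x"
proof -
  let ?D = "\<lambda>y. Phi y - gauss_Taylor n y / sqrt (2 * pi)"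
  have "?D 0 \<le> ?D x"
  proof (rule DERIV_nonneg_imp_nondecreasing[OF assms(1)])
    fix y :: real
    have "(?D has_real_derivative
        std_normal_density y - (\<Sum>m<n. (- (y\<^sup>2 / 2)) ^ m / fact m) / sqrt (2 * pi)) (at y)"
      by (intro DERIV_diff DERIV_Phi DERIV_cdivide DERIV_gauss_Taylor)
    moreover have "(\<Sum>m<n. (- (y\<^sup>2 / 2)) ^ m / fact m) / sqrt (2 * pi) \<le> std_normal_density y"
      using exp_minus_ge_Taylor_even[of "y\<^sup>2 / 2" n] assms(2)
      by (simp add: std_normal_density_def divide_right_mono)
    ultimately show "\<exists>d. (?D has_real_derivative d) (at y) \<and> 0 \<le> d"
      by force
  qed
  then show ?thesis
    by (simp add: Phi_0 gauss_Taylor_0)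
qed

lemma Phi_le_gauss_Taylor_odd:
  assumes "x \<ge> 0" "odd n"
  shows "Phi x \<le> 1 / 2 + gauss_Taylor n x / sqrt (2 * pi)"
proof -
  let ?D = "\<lambda>y. gauss_Taylor n y / sqrt (2 * pi) - Phi y"
  have "?D 0 \<le> ?D x"
  proof (rule DERIV_nonneg_imp_nondecreasing[OF assms(1)])
    fix y :: real
    have "(?D has_real_derivative
        (\<Sum>m<n. (- (y\<^sup>2 / 2)) ^ m / fact m) / sqrt (2 * pi) - std_normal_density y) (at y)"
      by (intro DERIV_diff DERIV_Phi DERIV_cdivide DERIV_gauss_Taylor)
    moreover have "std_normal_density y \<le> (\<Sum>m<n. (- (y\<^sup>2 / 2)) ^ m / fact m) / sqrt (2 * pi)"
      using exp_minus_le_Taylor_odd[of "y\<^sup>2 / 2" n] assms(2)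
      by (simp add: std_normal_density_def divide_right_mono)
    ultimately show "\<exists>d. (?D has_real_derivative d) (at y) \<and> 0 \<le> d"
      by force
  qed
  then show ?thesis
    by (simp add: Phi_0 gauss_Taylor_0)
qed

section \<open>Rational enclosures of the threshold, its density and the slope\<close>

lemma sqrt_2pi_bounds: "2.506628 \<le> sqrt (2 * pi)" "sqrt (2 * pi) \<le> 2.506629"
proof -
  show "2.506628 \<le> sqrt (2 * pi)"
    by (rule real_le_rsqrt) (use pi_approx in \<open>simp add: power2_eq_square\<close>)
  show "sqrt (2 * pi) \<le> 2.506629"
    by (rule real_le_lsqrt) (use pi_approx in \<open>simp_all add: power2_eq_square\<close>)
qed

lemma Phi_less: "Phi 1.4077 < 1 - F_G"
proof -
  \<comment> \<open>0.4204 is 1 - \<open>F_G\<close> - 1/2. Nine terms, an odd number, bound from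
    above; the truncation error is below 10^-6, while \<open>Phi\<close> falls short of its target
    by about 10^-5.\<close>
  have "gauss_Taylor 9 1.4077 < (0.4204 :: real) * 2.506628"
    by (simp add: gauss_Taylor_def lessThan_nat_numeral fact_numeral power_divide)
  also have "\<dots> \<le> 0.4204 * sqrt (2 * pi)"
    using sqrt_2pi_bounds by simp
  finally have Taylor: "gauss_Taylor 9 1.4077 / sqrt (2 * pi) < 0.4204"
    by (simp add: pos_divide_less_eq)
  have "Phi 1.4077 \<le> 1 / 2 + gauss_Taylor 9 1.4077 / sqrt (2 * pi)"
    by (rule Phi_le_gauss_Taylor_odd) auto
  also have "\<dots> < 1 / 2 + 0.4204"
    by (rule add_strict_left_mono[OF Taylor])
  finally show ?thesis
    by (simp add: F_G_def)
qed

lemma Phi_greater: "1 - F_G < Phi 1.4079"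
proof -
  \<comment> \<open>All roundings are reversed: an even number of terms and the upper bound for sqrt
    (2 pi).\<close>
  have "0.4204 * sqrt (2 * pi) \<le> (0.4204 :: real) * 2.506629"
    using sqrt_2pi_bounds by simp
  also have "\<dots> < gauss_Taylor 8 1.4079"
    by (simp add: gauss_Taylor_def lessThan_nat_numeral fact_numeral power_divide)
  finally have Taylor: "0.4204 < gauss_Taylor 8 1.4079 / sqrt (2 * pi)"
    by (simp add: pos_less_divide_eq)
  have "1 / 2 + 0.4204 < 1 / 2 + gauss_Taylor 8 1.4079 / sqrt (2 * pi)"
    by (rule add_strict_left_mono[OF Taylor])
  also have "\<dots> \<le> Phi 1.4079"
    by (rule Phi_ge_gauss_Taylor_even) auto
  finally show ?thesis
    by (simp add: F_G_def)
qed

text \<open>\<open>the_inv\<close> is informative only on the range of \<open>Phi\<close>, so the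
  intermediate value theorem first supplies a preimage; injectivity identifies it with
  \<open>x_c\<close>, and strict monotonicity turns the bounds on \<open>Phi\<close> into bounds on
  \<open>x_c\<close>.\<close>

lemma Phi_x_c: "Phi x_c = 1 - F_G"
  and x_c_bounds: "1.4077 < x_c" "x_c < 1.4079"
proof -
  obtain x where x: "Phi x = 1 - F_G"
    using IVT[of Phi "1.4077" "1 - F_G" "1.4079"] Phi_less Phi_greater DERIV_isCont[OF DERIV_Phi]
    by force
  then have "x_c = x"
    unfolding x_c_def by (metis the_inv_f_f strict_mono_Phi strict_mono_imp_inj_on)
  with x show eq: "Phi x_c = 1 - F_G"
    by simp
  show "1.4077 < x_c" "x_c < 1.4079"
    using Phi_less Phi_greater unfolding eq[symmetric] by (simp_all add: strict_mono_less[OF strict_mono_Phi])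
qed

lemma std_normal_density_x_c_bounds:
  "0.14806 \<le> std_normal_density x_c" "std_normal_density x_c \<le> 0.14812"
proof -
  \<comment> \<open>The density decreases on the positive axis, so the upper endpoint yields its
    lower bound and conversely.\<close>
  have sq: "1.4077\<^sup>2 \<le> x_c\<^sup>2" "x_c\<^sup>2 \<le> 1.4079\<^sup>2"
    using x_c_bounds by (auto intro!: power_mono)
  have "0.14806 * sqrt (2 * pi) \<le> (0.14806 :: real) * 2.506629"
    using sqrt_2pi_bounds by simp
  also have "\<dots> \<le> (\<Sum>m<8. (- (1.4079\<^sup>2 / 2)) ^ m / fact m)"
    by (simp add: lessThan_nat_numeral fact_numeral power_divide)
  also have "\<dots> \<le> exp (- (1.4079\<^sup>2 / 2))"
    by (rule exp_minus_ge_Taylor_even) auto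
  also have "\<dots> \<le> exp (- x_c\<^sup>2 / 2)"
    using sq by simp
  finally show "0.14806 \<le> std_normal_density x_c"
    by (simp add: std_normal_density_def pos_le_divide_eq)
  have "exp (- x_c\<^sup>2 / 2) \<le> exp (- (1.4077\<^sup>2 / 2))"
    using sq by simp
  also have "\<dots> \<le> (\<Sum>m<9. (- (1.4077\<^sup>2 / 2)) ^ m / fact m)"
    by (rule exp_minus_le_Taylor_odd) auto
  also have "\<dots> \<le> (0.14812 :: real) * 2.506628"
    by (simp add: lessThan_nat_numeral fact_numeral power_divide)
  also have "\<dots> \<le> 0.14812 * sqrt (2 * pi)"
    using sqrt_2pi_bounds by simp
  finally show "std_normal_density x_c \<le> 0.14812"
    by (simp add: std_normal_density_def pos_divide_le_eq)
qed

lemma response_ratio_bounds: "\<bar>2 * response_amplitude / F_G - 0.609\<bar> < 0.0005"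
proof -
  have sq: "1.4077\<^sup>2 - 1 \<le> x_c\<^sup>2 - 1" "x_c\<^sup>2 - 1 \<le> 1.4079\<^sup>2 - 1"
    using x_c_bounds by (auto intro!: power_mono)
  \<comment> \<open>The slope is p / (3 \<open>F_G\<close>); multiplying the enclosures of the two
    positive factors places it between 0.6086 and 0.6093.\<close>
  define p where "p = (x_c\<^sup>2 - 1) * std_normal_density x_c"
  have "(1.4077\<^sup>2 - 1) * 0.14806 \<le> p"
    unfolding p_def
    using sq std_normal_density_x_c_bounds by (intro mult_mono) (auto simp: power2_eq_square)
  moreover have "p \<le> (1.4079\<^sup>2 - 1) * 0.14812"
    unfolding p_def
    using sq std_normal_density_x_c_bounds by (intro mult_mono) (auto simp: power2_eq_square)
  ultimately have "\<bar>2 * (p / 6) / F_G - 0.609\<bar> < 0.0005"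
    unfolding abs_less_iff by (simp add: F_G_def power2_eq_square)
  then show ?thesis
    by (simp add: response_amplitude_def p_def)
qed

theorem mainTheorem4:
  shows "(\<forall>\<epsilon>::real.
            cluster_fraction \<epsilon> = F_G + response_amplitude * \<epsilon> \<and>
            void_fraction \<epsilon> = F_G - response_amplitude * \<epsilon> \<and>
            asymmetry \<epsilon> = 2 * response_amplitude / F_G * \<epsilon>) \<and>
         \<bar>2 * response_amplitude / F_G - 0.609\<bar> < 0.0005"
proof (intro conjI allI)
  fix \<epsilon> :: real
  \<comment> \<open>The calibration \<open>Phi_x_c\<close> turns the Gaussian part of either tail
    into \<open>F_G\<close>.\<close>
  show cluster: "cluster_fraction \<epsilon> = F_G + response_amplitude * \<epsilon>"
    by (simp add: cluster_fraction_def upper_tail_edgeworth_density Phi_x_c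
        response_amplitude_def)
  show void: "void_fraction \<epsilon> = F_G - response_amplitude * \<epsilon>"
    by (simp add: void_fraction_def lower_tail_edgeworth_density
        upper_tail_edgeworth_density Phi_x_c response_amplitude_def)
  show "asymmetry \<epsilon> = 2 * response_amplitude / F_G * \<epsilon>"
    by (simp add: asymmetry_def cluster void)
qed (rule response_ratio_bounds)

end
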